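(* Let $d,K,n$ be positive integers with $K\ge 2$ and $d\ge K$, let $N=nK$, let $\lambda_W,\lambda_H,\lambda_b>0$ and $\delta\in[0,1)$. Set $\lambda_Z:=\sqrt{\lambda_W\lambda_H}$ and define $$a^\delta:=\begin{cases}0 & \text{if } \sqrt{KN}\,\lambda_Z+\delta\ge 1,\\[2pt] \log\!\left(\dfrac{K}{\sqrt{KN}\,\lambda_Z+\delta}-K+1\right) & \text{if } \sqrt{KN}\,\lambda_Z+\delta<1.\end{cases}$$ Let $(W,H,b)\in\mathbb{R}^{d\times K}\times\mathbb{R}^{d\times N}\times\mathbb{R}^K$ be any global minimizer of $$\mathcal{L}(W,H,b)=\frac1N\, l_{CE}\big(W^\top H+b\mathbf{1}_N^\top,\,Y^\delta\big)+\frac{\lambda_W}{2}\|W\|_F^2+\frac{\lambda_H}{2}\|H\|_F^2+\frac{\lambda_b}{2}\|b\|^2 .$$ Then there is a matrix $P\in\mathbb{R}^{d\times K}$ with $P^\top P=I_K$ such that: (i) $W=\left(\dfrac{n\lambda_H}{\lambda_W}\right)^{1/4}\sqrt{a^\delta}\;P\left(I_K-\tfrac1K\mathbf{1}_K\mathbf{1}_K^\top\right)$; (ii) $H=\left(\dfrac{\lambda_W}{n\lambda_H}\right)^{1/4}\sqrt{a^\delta}\;P\left(I_K-\tfrac1K\mathbf{1}_K\mathbf{1}_K^\top\right)Y$; (iii) $b=0$.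
   Context: $\mathbf{1}_m\in\mathbb{R}^m$ is the all-ones vector, $I_K$ the identity, $e_k$ the $k$-th standard basis vector of $\mathbb{R}^K$. The dataset is balanced: $K$ classes with $n$ samples each. The label matrix is $Y=[e_1\mathbf{1}_n^\top,\dots,e_K\mathbf{1}_n^\top]\in\mathbb{R}^{K\times N}$ (each $e_k$ repeated in $n$ consecutive columns), and the smoothed label matrix is $Y^\delta=(1-\delta)Y+\frac{\delta}{K}\mathbf{1}_K\mathbf{1}_N^\top$. For a logit vector $z\in\mathbb{R}^K$ and a target vector $y\in\mathbb{R}^K$, $l_{CE}(z,y)=-\sum_{j=1}^K y_j\log p_j$ with $p=\mathrm{Softmax}(z)$, i.e. $p_j=e^{z_j}/\sum_{m}e^{z_m}$. For matrices in $\mathbb{R}^{K\times N}$, $l_{CE}$ is the sum of the column-wise values. $\|\cdot\|_F$ is the Frobenius norm and $\|\cdot\|$ the Euclidean norm. *)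

theory Defs
  imports Complex_Main "Jordan_Normal_Form.Matrix"
begin

definition ones_vec :: "nat \<Rightarrow> real vec" where
  "ones_vec m = vec m (\<lambda>_. 1)"

text \<open>\<open>outer_prod u v\<close> is \<open>u v\<^sup>T\<close>.\<close>

definition outer_prod :: "real vec \<Rightarrow> real vec \<Rightarrow> real mat" where
  "outer_prod u v = mat (dim_vec u) (dim_vec v) (\<lambda>(i, j). u $ i * v $ j)"

definition eucl_norm :: "real vec \<Rightarrow> real" where
  "eucl_norm v = sqrt (\<Sum>i<dim_vec v. (v $ i)\<^sup>2)"

definition frob_norm :: "real mat \<Rightarrow> real" where
  "frob_norm A = sqrt (\<Sum>i<dim_row A. \<Sum>j<dim_col A. (A $$ (i, j))\<^sup>2)"

definition softmax :: "real vec \<Rightarrow> real vec" where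
  "softmax z = vec (dim_vec z) (\<lambda>j. exp (z $ j) / (\<Sum>m<dim_vec z. exp (z $ m)))"

definition cross_entropy :: "real vec \<Rightarrow> real vec \<Rightarrow> real" where
  "cross_entropy z y = - (\<Sum>j<dim_vec z. y $ j * ln (softmax z $ j))"

definition cross_entropy_mat :: "real mat \<Rightarrow> real mat \<Rightarrow> real" where
  "cross_entropy_mat Z Y = (\<Sum>j<dim_col Z. cross_entropy (col Z j) (col Y j))"

text \<open>Indices start at 0, so column \<open>j\<close> belongs to class \<open>j div n\<close>: each standard basis
  vector fills \<open>n\<close> consecutive columns.\<close>

definition label_mat :: "nat \<Rightarrow> nat \<Rightarrow> real mat" where
  "label_mat K n = mat_of_cols K (map (\<lambda>j. unit_vec K (j div n)) [0..<n * K])"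

definition smoothed_label_mat :: "nat \<Rightarrow> nat \<Rightarrow> real \<Rightarrow> real mat" where
  "smoothed_label_mat K n \<delta> =
     (1 - \<delta>) \<cdot>\<^sub>m label_mat K n
     + (\<delta> / real K) \<cdot>\<^sub>m outer_prod (ones_vec K) (ones_vec (n * K))"

definition ce_loss ::
  "nat \<Rightarrow> nat \<Rightarrow> real \<Rightarrow> real \<Rightarrow> real \<Rightarrow> real \<Rightarrow> real mat \<Rightarrow> real mat \<Rightarrow> real vec \<Rightarrow> real" where
  "ce_loss K n lamW lamH lamb \<delta> W H b =
     1 / real (n * K) *
       cross_entropy_mat (transpose_mat W * H + outer_prod b (ones_vec (n * K)))
         (smoothed_label_mat K n \<delta>)
     + lamW / 2 * (frob_norm W)\<^sup>2
     + lamH / 2 * (frob_norm H)\<^sup>2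
     + lamb / 2 * (eucl_norm b)\<^sup>2"

definition is_global_minimizer ::
  "nat \<Rightarrow> nat \<Rightarrow> nat \<Rightarrow> (real mat \<Rightarrow> real mat \<Rightarrow> real vec \<Rightarrow> real)
     \<Rightarrow> real mat \<Rightarrow> real mat \<Rightarrow> real vec \<Rightarrow> bool" where
  "is_global_minimizer d K N L W H b \<longleftrightarrow>
     W \<in> carrier_mat d K \<and> H \<in> carrier_mat d N \<and> b \<in> carrier_vec K \<and>
     (\<forall>W' \<in> carrier_mat d K. \<forall>H' \<in> carrier_mat d N. \<forall>b' \<in> carrier_vec K.
        L W H b \<le> L W' H' b')"

definition a_smooth :: "nat \<Rightarrow> nat \<Rightarrow> real \<Rightarrow> real \<Rightarrow> real \<Rightarrow> real" where
  "a_smooth K n lamW lamH \<delta> =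
     (let lamZ = sqrt (lamW * lamH);
          t = sqrt (real K * real (n * K)) * lamZ + \<delta>
      in if t \<ge> 1 then 0 else ln (real K / t - real K + 1))"

definition centering_mat :: "nat \<Rightarrow> real mat" where
  "centering_mat K = 1\<^sub>m K - (1 / real K) \<cdot>\<^sub>m outer_prod (ones_vec K) (ones_vec K)"

end

(* Logsumexp is convex, so it lies above its tangent plane at the logits of the claimed solution.
   With S = exp a + K - 1 and c = 1/S - delta/K, the softmax of those logits differs from the
   smoothed label of class k by c (1 - K e_k). Balancedness then removes the bias from the linear
   term, and completing the square in H turns the loss into an exact sum: a constant, the
   nonnegative tangent-plane gaps, and nonnegative multiples of
     |H - c/(n lamH) (W - mean) Y|^2,  |W - mean|^2,  |mean|^2  and  |b|^2,
   where mean is the average column of W. The choice of a makes the coefficient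
   (lamW - c^2/(n lamH))/2 of |W - mean|^2 nonnegative, and zero whenever a > 0. The claimed
   solution annihilates every term, hence so does every minimizer, which fixes b, H and the Gram
   matrix of W. *)

theory Submission
  imports Defs "Jordan_Normal_Form.Determinant"
begin

section \<open>Logsumexp and the gap to its tangent plane\<close>

definition lse :: "nat \<Rightarrow> (nat \<Rightarrow> real) \<Rightarrow> real" where
  "lse K z = ln (\<Sum>m<K. exp (z m))"

text \<open>This is the Bregman divergence of logsumexp, that is, the Kullback-Leibler divergence of
  the softmax of \<open>z\<close> from the softmax of \<open>v\<close>.\<close>

definition lse_gap :: "nat \<Rightarrow> (nat \<Rightarrow> real) \<Rightarrow> (nat \<Rightarrow> real) \<Rightarrow> real" where
  "lse_gap K z v = lse K z - lse K v
     - (\<Sum>m<K. exp (v m) / (\<Sum>l<K. exp (v l)) * (z m - v m))"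

text \<open>The deviations \<open>u m - \<mu>\<close> have weighted mean zero, so the bound
  \<open>exp x \<ge> 1 + x\<close> turns the weighted mean of \<open>exp (u m - \<mu>)\<close> into
  1 plus nonnegative remainders \<open>r m\<close>. Equality forces every remainder, hence every
  deviation, to vanish.\<close>

lemma jensen_exp:
  fixes p u :: "'a \<Rightarrow> real"
  assumes "finite A" and pos: "\<And>m. m \<in> A \<Longrightarrow> p m > 0" and "sum p A = 1"
  defines "\<mu> \<equiv> (\<Sum>m\<in>A. p m * u m)"
  shows "\<mu> \<le> ln (\<Sum>m\<in>A. p m * exp (u m))"
    and "\<mu> = ln (\<Sum>m\<in>A. p m * exp (u m)) \<longleftrightarrow> (\<forall>m\<in>A. u m = \<mu>)"
proof -
  define r where "r m = p m * (exp (u m - \<mu>) - 1 - (u m - \<mu>))" for m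
  have r0: "r m \<ge> 0" if "m \<in> A" for m
    using exp_ge_add_one_self[of "u m - \<mu>"] pos[OF that]
    unfolding r_def by (intro mult_nonneg_nonneg) linarith+
  have "(\<Sum>m\<in>A. p m * (u m - \<mu>)) = 0"
    using assms(3) by (simp add: right_diff_distrib sum_subtractf \<mu>_def flip: sum_distrib_right)
  then have sum_r: "(\<Sum>m\<in>A. p m * exp (u m - \<mu>)) = 1 + sum r A"
    using assms(3) by (simp add: r_def right_diff_distrib sum_subtractf)
  have "(\<Sum>m\<in>A. p m * exp (u m)) = exp \<mu> * (\<Sum>m\<in>A. p m * exp (u m - \<mu>))"
    by (simp add: sum_distrib_left exp_diff)
  then have eq: "ln (\<Sum>m\<in>A. p m * exp (u m)) = \<mu> + ln (1 + sum r A)"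
    using sum_nonneg[of A r] r0 by (simp add: sum_r ln_mult)
  have nn: "sum r A \<ge> 0" using r0 by (intro sum_nonneg)
  show "\<mu> \<le> ln (\<Sum>m\<in>A. p m * exp (u m))"
    using eq nn by simp
  have "\<mu> = ln (\<Sum>m\<in>A. p m * exp (u m)) \<longleftrightarrow> sum r A = 0"
    using eq nn by simp
  also have "\<dots> \<longleftrightarrow> (\<forall>m\<in>A. r m = 0)"
    using r0 assms(1) by (intro sum_nonneg_eq_0_iff)
  also have "\<dots> \<longleftrightarrow> (\<forall>m\<in>A. u m = \<mu>)"
  proof (intro ball_cong refl)
    fix m assume "m \<in> A"
    \<comment> \<open>With \<open>y = exp x\<close> this is the equality case of
      \<open>ln y \<le> y - 1\<close>.\<close>
    have "exp x - 1 - x = 0 \<longleftrightarrow> x = 0" for x :: real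
      using ln_eq_minus_one[of "exp x"] by auto
    then show "r m = 0 \<longleftrightarrow> u m = \<mu>"
      using pos[OF \<open>m \<in> A\<close>] by (auto simp: r_def)
  qed
  finally show "\<mu> = ln (\<Sum>m\<in>A. p m * exp (u m)) \<longleftrightarrow> (\<forall>m\<in>A. u m = \<mu>)" .
qed

text \<open>The gap is the deficit in Jensen's inequality for \<open>u = z - v\<close> under the
  softmax weights of \<open>v\<close>. It vanishes exactly on common shifts of \<open>v\<close>, the
  directions to which softmax is blind.\<close>

lemma lse_gap_nonneg_and_zero_iff:
  assumes "K > 0"
  shows "lse_gap K z v \<ge> 0"
    and "lse_gap K z v = 0 \<longleftrightarrow> (\<exists>\<mu>. \<forall>m<K. z m = v m + \<mu>)"
proof -
  define S where "S = (\<Sum>l<K. exp (v l))"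
  define p where "p m = exp (v m) / S" for m
  define u where "u m = z m - v m" for m
  have S: "S > 0" unfolding S_def using assms by (intro sum_pos) auto
  have p: "p m > 0" for m using S by (simp add: p_def)
  have p1: "sum p {..<K} = 1" using S by (simp add: p_def S_def flip: sum_divide_distrib)
  have "(\<Sum>m<K. exp (z m)) = S * (\<Sum>m<K. p m * exp (u m))"
    using S by (simp add: p_def u_def sum_distrib_left exp_diff)
  moreover have "(\<Sum>m<K. p m * exp (u m)) > 0"
    using assms p by (intro sum_pos) auto
  ultimately have "lse_gap K z v = ln (\<Sum>m<K. p m * exp (u m)) - (\<Sum>m<K. p m * u m)"
    using S by (simp add: lse_gap_def lse_def ln_mult S_def[symmetric] p_def u_def)
  note gap = this and j = jensen_exp[of "{..<K}" p u, OF _ p p1, simplified]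
  show "lse_gap K z v \<ge> 0" using gap j(1) by simp
  have "lse_gap K z v = 0 \<longleftrightarrow> (\<forall>m<K. u m = (\<Sum>m<K. p m * u m))"
    using gap j(2) by auto
  also have "\<dots> \<longleftrightarrow> (\<exists>\<mu>. \<forall>m<K. u m = \<mu>)"
  proof
    assume "\<exists>\<mu>. \<forall>m<K. u m = \<mu>"
    then obtain \<mu> where \<mu>: "\<And>m. m < K \<Longrightarrow> u m = \<mu>" by blast
    then have "(\<Sum>m<K. p m * u m) = \<mu>"
      using p1 by (simp flip: sum_distrib_right)
    with \<mu> show "\<forall>m<K. u m = (\<Sum>m<K. p m * u m)" by simp
  qed blast
  finally show "lse_gap K z v = 0 \<longleftrightarrow> (\<exists>\<mu>. \<forall>m<K. z m = v m + \<mu>)"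
    by (simp add: u_def algebra_simps)
qed

section \<open>Balanced sums and the exact decomposition of the loss\<close>

lemma sum_div_blocks:
  fixes f :: "nat \<Rightarrow> real"
  shows "(\<Sum>j<n * K. f (j div n)) = real n * (\<Sum>k<K. f k)"
proof -
  have "(\<Sum>j<n * K. f (j div n)) = (\<Sum>k<K. \<Sum>j=k * n..<k * n + n. f (j div n))"
    by (simp add: sum.nat_group mult.commute)
  also have "\<dots> = (\<Sum>k<K. \<Sum>j=k * n..<k * n + n. f k)"
    by (intro sum.cong refl arg_cong[of _ _ f] div_nat_eqI) (auto simp: mult.commute)
  finally show ?thesis by (simp add: sum_distrib_left)
qed

lemma sum_delta_lessThan:
  fixes f :: "nat \<Rightarrow> real"
  assumes "k < K"
  shows "(\<Sum>m<K. of_bool (m = k) * f m) = f k" "(\<Sum>m<K. f m * of_bool (m = k)) = f k"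
  using assms by (simp_all add: of_bool_def if_distrib[of "\<lambda>x. x * _"] if_distrib[of "\<lambda>x. _ * x"]
      sum.delta' cong: if_cong)

text \<open>Logsumexp is expanded at \<open>v = a e_k\<close>, whose softmax is \<open>1 / S\<close>
  off class \<open>k\<close> and \<open>exp a / S\<close> on it. Subtracting the smoothed label
  leaves \<open>1 / S - \<delta> / K\<close> off the class and \<open>1 - K\<close> times that
  number on it, which gives the linear term.\<close>

lemma ce_tangent:
  fixes z :: "nat \<Rightarrow> real" and a \<delta> :: real
  assumes "k < K"
  defines "S \<equiv> exp a + real K - 1"
  shows "lse K z - (\<Sum>m<K. ((1 - \<delta>) * of_bool (m = k) + \<delta> / real K) * z m)
    = ln S - a * exp a / S + lse_gap K z (\<lambda>m. a * of_bool (m = k))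
      + (1 / S - \<delta> / real K) * ((\<Sum>m<K. z m) - real K * z k)"
proof -
  define v where "v m = a * of_bool (m = k)" for m
  have S0: "S > 0" using assms by (simp add: S_def add_pos_nonneg add_diff_eq[symmetric])
  have K0: "real K > 0" using assms by simp
  have ex: "exp (v m) = 1 + (exp a - 1) * of_bool (m = k)" for m
    by (simp add: v_def)
  note pick = sum_delta_lessThan(1)[OF assms(1)]
  have Sv: "(\<Sum>l<K. exp (v l)) = S"
    using pick[of "\<lambda>_. exp a - 1"] by (simp add: ex sum.distrib S_def mult.commute)
  have "exp (v m) / S * (z m - v m)
      = ((z m - v m) + of_bool (m = k) * ((exp a - 1) * (z m - v m))) / S" for m
    by (simp add: ex algebra_simps)
  then have "(\<Sum>m<K. exp (v m) / S * (z m - v m))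
      = ((\<Sum>m<K. z m - v m) + (exp a - 1) * (z k - v k)) / S"
    by (simp only: sum.distrib pick flip: sum_divide_distrib)
  also have "\<dots> = ((\<Sum>m<K. z m) + (exp a - 1) * z k - a * exp a) / S"
    using pick[of "\<lambda>_. a"] by (simp add: v_def sum_subtractf mult.commute algebra_simps)
  finally have q: "(\<Sum>m<K. exp (v m) / S * (z m - v m))
      = ((\<Sum>m<K. z m) + (exp a - 1) * z k - a * exp a) / S" .
  have "((1 - \<delta>) * of_bool (m = k) + \<delta> / real K) * z m
      = of_bool (m = k) * ((1 - \<delta>) * z m) + \<delta> / real K * z m" for m
    by (simp add: algebra_simps)
  then have y: "(\<Sum>m<K. ((1 - \<delta>) * of_bool (m = k) + \<delta> / real K) * z m)
      = (1 - \<delta>) * z k + \<delta> / real K * (\<Sum>m<K. z m)"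
    by (simp only: sum.distrib pick flip: sum_distrib_left)
  \<comment> \<open>Writing \<open>S - real K\<close> for \<open>exp a - 1\<close> leaves
    \<open>exp a\<close> only in the constant, so the rest is rational in \<open>S\<close>.\<close>
  have "lse_gap K z v = lse K z - ln S - ((\<Sum>m<K. z m) + (S - real K) * z k - a * exp a) / S"
    unfolding lse_gap_def Sv q by (simp add: lse_def Sv S_def)
  note gap = this[unfolded v_def]
  show ?thesis
    unfolding y gap using S0 K0 by (simp add: field_simps)
qed

text \<open>An identity for all \<open>w\<close>, \<open>h\<close> and \<open>b\<close>, so nothing
  is lost by estimation. The linear terms of the tangent planes are absorbed by completing the
  square in \<open>h\<close>; the price is charged to the centred part of the penalty on
  \<open>w\<close>.\<close>

lemma regularized_loss_decomposition:
  fixes w h :: "nat \<Rightarrow> nat \<Rightarrow> real" and b :: "nat \<Rightarrow> real"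
    and a \<delta> lamW lamH :: real and n K d :: nat
  assumes "n > 0" "K > 0" "lamH > 0"
  defines "S \<equiv> exp a + real K - 1"
  defines "c \<equiv> 1 / S - \<delta> / real K"
  defines "mean \<equiv> \<lambda>i. (\<Sum>m<K. w i m) / real K"
  defines "z \<equiv> \<lambda>j m. (\<Sum>i<d. w i m * h i j) + b m"
  shows "1 / real (n * K) * (\<Sum>j<n * K. lse K (z j)
        - (\<Sum>m<K. ((1 - \<delta>) * of_bool (m = j div n) + \<delta> / real K) * z j m))
      + lamW / 2 * (\<Sum>i<d. \<Sum>k<K. (w i k)\<^sup>2) + lamH / 2 * (\<Sum>i<d. \<Sum>j<n * K. (h i j)\<^sup>2)
    = ln S - a * exp a / S
      + 1 / real (n * K) * (\<Sum>j<n * K. lse_gap K (z j) (\<lambda>m. a * of_bool (m = j div n)))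
      + lamH / 2 * (\<Sum>i<d. \<Sum>j<n * K. (h i j - c / (real n * lamH) * (w i (j div n) - mean i))\<^sup>2)
      + (lamW - c\<^sup>2 / (real n * lamH)) / 2 * (\<Sum>i<d. \<Sum>k<K. (w i k - mean i)\<^sup>2)
      + lamW / 2 * real K * (\<Sum>i<d. (mean i)\<^sup>2)"
proof -
  define N where "N = real (n * K)"
  define G where "G = (\<Sum>j<n * K. lse_gap K (z j) (\<lambda>m. a * of_bool (m = j div n)))"
  define x where "x i k = w i k - mean i" for i k
  have n0: "real n > 0" and K0: "real K > 0" using assms(1,2) by simp_all
  have NnK: "N = real n * real K" by (simp add: N_def)
  have cls: "j div n < K" if "j < n * K" for j
    using that by (simp add: less_mult_imp_div_less mult.commute)
  have wsum: "(\<Sum>m<K. w i m) = real K * mean i" for i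
    using K0 by (simp add: mean_def)
  \<comment> \<open>The class total of \<open>w i\<close> is \<open>K\<close> times its mean, so
    only the centred columns \<open>x\<close> survive here.\<close>
  have logit_diff: "(\<Sum>m<K. z j m) - real K * z j k
      = - real K * (\<Sum>i<d. h i j * x i k) + ((\<Sum>m<K. b m) - real K * b k)" for j k
  proof -
    have "(\<Sum>m<K. \<Sum>i<d. w i m * h i j) = (\<Sum>i<d. h i j * (\<Sum>m<K. w i m))"
      by (subst sum.swap) (simp add: sum_distrib_left mult.commute)
    also have "\<dots> = real K * (\<Sum>i<d. h i j * mean i)"
      by (simp add: wsum sum_distrib_left mult.left_commute)
    finally show ?thesis
      by (simp add: z_def x_def sum.distrib algebra_simps sum_subtractf)
  qed
  \<comment> \<open>Every class has \<open>n\<close> samples, so \<open>K * b k\<close> summed over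
    all samples equals the summed total of \<open>b\<close>.\<close>
  have bias: "(\<Sum>j<n * K. (\<Sum>m<K. b m) - real K * b (j div n)) = 0"
    by (simp add: sum_subtractf sum_div_blocks flip: sum_distrib_left)
  have "(\<Sum>j<n * K. (\<Sum>m<K. z j m) - real K * z j (j div n))
      = - real K * (\<Sum>j<n * K. \<Sum>i<d. h i j * x i (j div n))"
    using bias by (simp only: logit_diff sum.distrib flip: sum_distrib_left)
  also have "\<dots> = - real K * (\<Sum>i<d. \<Sum>j<n * K. h i j * x i (j div n))"
    by (subst sum.swap) simp
  finally have lin: "(\<Sum>j<n * K. (\<Sum>m<K. z j m) - real K * z j (j div n))
      = - real K * (\<Sum>i<d. \<Sum>j<n * K. h i j * x i (j div n))" .
  have "(\<Sum>j<n * K. lse K (z j)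
        - (\<Sum>m<K. ((1 - \<delta>) * of_bool (m = j div n) + \<delta> / real K) * z j m))
     = (\<Sum>j<n * K. (ln S - a * exp a / S) + lse_gap K (z j) (\<lambda>m. a * of_bool (m = j div n))
        + c * ((\<Sum>m<K. z j m) - real K * z j (j div n)))"
    unfolding c_def S_def by (intro sum.cong refl ce_tangent cls) simp
  also have "\<dots> = N * (ln S - a * exp a / S) + G
      + c * (- real K * (\<Sum>i<d. \<Sum>j<n * K. h i j * x i (j div n)))"
    unfolding lin[symmetric] by (simp add: sum.distrib G_def N_def flip: sum_distrib_left)
  finally have X: "(\<Sum>j<n * K. lse K (z j)
        - (\<Sum>m<K. ((1 - \<delta>) * of_bool (m = j div n) + \<delta> / real K) * z j m))
     = N * (ln S - a * exp a / S) + G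
      + c * (- real K * (\<Sum>i<d. \<Sum>j<n * K. h i j * x i (j div n)))" .
  have "1 / N * (N * A + G + c * (- real K * Q)) = A + 1 / N * G - c / real n * Q" for A Q
    using n0 K0 by (simp add: NnK field_simps)
  note ce = this[of "ln S - a * exp a / S" "\<Sum>i<d. \<Sum>j<n * K. h i j * x i (j div n)", folded X]
  \<comment> \<open>The shift \<open>c / (n * lamH)\<close> is the minimizer in \<open>h\<close> of
    the quadratic on the left.\<close>
  have "lamH / 2 * (h i j)\<^sup>2 - c / real n * (h i j * x i k)
      = lamH / 2 * (h i j - c / (real n * lamH) * x i k)\<^sup>2
        - c\<^sup>2 / (2 * (real n)\<^sup>2 * lamH) * (x i k)\<^sup>2" for i j k
    using n0 assms(3) by (simp add: field_simps power2_eq_square)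
  then have "(\<Sum>i<d. \<Sum>j<n * K. lamH / 2 * (h i j)\<^sup>2 - c / real n * (h i j * x i (j div n)))
      = (\<Sum>i<d. \<Sum>j<n * K. lamH / 2 * (h i j - c / (real n * lamH) * x i (j div n))\<^sup>2
        - c\<^sup>2 / (2 * (real n)\<^sup>2 * lamH) * (x i (j div n))\<^sup>2)"
    by simp
  then have sq: "lamH / 2 * (\<Sum>i<d. \<Sum>j<n * K. (h i j)\<^sup>2)
        - c / real n * (\<Sum>i<d. \<Sum>j<n * K. h i j * x i (j div n))
      = lamH / 2 * (\<Sum>i<d. \<Sum>j<n * K. (h i j - c / (real n * lamH) * x i (j div n))\<^sup>2)
        - c\<^sup>2 / (2 * (real n)\<^sup>2 * lamH) * (\<Sum>i<d. \<Sum>j<n * K. (x i (j div n))\<^sup>2)"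
    by (simp only: sum_subtractf sum_distrib_left)
  \<comment> \<open>The remainder depends on the sample only through its class; the factor
    \<open>n\<close> cancels one power of \<open>n\<close> in its coefficient.\<close>
  have blocks: "(\<Sum>i<d. \<Sum>j<n * K. (x i (j div n))\<^sup>2) = real n * (\<Sum>i<d. \<Sum>k<K. (x i k)\<^sup>2)"
    using sum_div_blocks[where f = "\<lambda>k. (x i k)\<^sup>2" for i] by (simp only: flip: sum_distrib_left)
  \<comment> \<open>Pythagoras: the deviations from the mean sum to zero, so the cross term drops
    out.\<close>
  have "(\<Sum>k<K. (w i k)\<^sup>2) = (\<Sum>k<K. (x i k)\<^sup>2) + real K * (mean i)\<^sup>2" for i
  proof -
    have "(\<Sum>k<K. x i k) = 0"
      using K0 by (simp add: x_def mean_def sum_subtractf)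
    moreover have "(w i k)\<^sup>2 = (x i k)\<^sup>2 + 2 * mean i * x i k + (mean i)\<^sup>2" for k
      by (simp add: x_def power2_eq_square algebra_simps)
    ultimately show ?thesis
      by (simp add: sum.distrib flip: sum_distrib_left)
  qed
  then have wsq: "(\<Sum>i<d. \<Sum>k<K. (w i k)\<^sup>2)
      = (\<Sum>i<d. \<Sum>k<K. (x i k)\<^sup>2) + real K * (\<Sum>i<d. (mean i)\<^sup>2)"
    by (simp add: sum.distrib sum_distrib_left)
  have coef: "c\<^sup>2 / (2 * (real n)\<^sup>2 * lamH) * (real n * t) = c\<^sup>2 / (real n * lamH) / 2 * t" for t
    using n0 by (simp add: power2_eq_square)
  have lin: "(lamW - q) / 2 * t = lamW / 2 * t - q / 2 * t"
      "lamW / 2 * (t + real K * u) = lamW / 2 * t + lamW / 2 * real K * u" for q t u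
    by (simp_all add: algebra_simps diff_divide_distrib)
  show ?thesis
    using ce sq unfolding N_def[symmetric] G_def[symmetric] x_def[symmetric] wsq blocks coef lin
    by linarith
qed

section \<open>The matrix loss in terms of its entries\<close>

lemma cross_entropy_eq_lse:
  assumes "dim_vec z = K" "K > 0" "(\<Sum>m<K. y $ m) = 1"
  shows "cross_entropy z y = lse K (\<lambda>m. z $ m) - (\<Sum>m<K. y $ m * z $ m)"
proof -
  have "(\<Sum>m<K. exp (z $ m)) > 0" using assms(2) by (intro sum_pos) auto
  then have "ln (softmax z $ j) = z $ j - lse K (\<lambda>m. z $ m)" if "j < K" for j
    using that assms(1) by (simp add: softmax_def lse_def ln_div)
  \<comment> \<open>Logsumexp is weighted by the total mass of \<open>y\<close>, which is 1.\<close>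
  then have "cross_entropy z y = (\<Sum>m<K. y $ m) * lse K (\<lambda>m. z $ m) - (\<Sum>m<K. y $ m * z $ m)"
    unfolding cross_entropy_def assms(1)
    by (simp add: right_diff_distrib sum_subtractf sum_distrib_right)
  with assms(3) show ?thesis by simp
qed

lemma label_mat_carrier [simp]: "label_mat K n \<in> carrier_mat K (n * K)"
  by (simp add: label_mat_def mat_of_cols_def)

lemma label_mat_index [simp]:
  "m < K \<Longrightarrow> j < n * K \<Longrightarrow> label_mat K n $$ (m, j) = of_bool (m = j div n)"
  by (auto simp: label_mat_def mat_of_cols_def unit_vec_def)

lemma smoothed_label_mat_index:
  "m < K \<Longrightarrow> j < n * K \<Longrightarrow>
    smoothed_label_mat K n \<delta> $$ (m, j) = (1 - \<delta>) * of_bool (m = j div n) + \<delta> / real K"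
  using carrier_matD[OF label_mat_carrier[of K n]]
  by (simp add: smoothed_label_mat_def outer_prod_def ones_vec_def)

lemma smoothed_label_mat_carrier: "smoothed_label_mat K n \<delta> \<in> carrier_mat K (n * K)"
  using carrier_matD[OF label_mat_carrier[of K n]]
  by (simp add: smoothed_label_mat_def outer_prod_def ones_vec_def)

text \<open>Each column of the smoothed label matrix has mass
  \<open>(1 - \<delta>) + \<delta> = 1\<close>, so the logsumexp form of the cross entropy applies
  column by column.\<close>

lemma ce_loss_entries:
  assumes "K > 0" and W: "W \<in> carrier_mat d K" and H: "H \<in> carrier_mat d (n * K)"
    and b: "b \<in> carrier_vec K"
  defines "z \<equiv> \<lambda>j m. (\<Sum>i<d. W $$ (i, m) * H $$ (i, j)) + b $ m"
  shows "ce_loss K n lamW lamH lamb \<delta> W H b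
    = 1 / real (n * K) * (\<Sum>j<n * K. lse K (z j)
        - (\<Sum>m<K. ((1 - \<delta>) * of_bool (m = j div n) + \<delta> / real K) * z j m))
      + lamW / 2 * (\<Sum>i<d. \<Sum>k<K. (W $$ (i, k))\<^sup>2)
      + lamH / 2 * (\<Sum>i<d. \<Sum>j<n * K. (H $$ (i, j))\<^sup>2)
      + lamb / 2 * (\<Sum>k<K. (b $ k)\<^sup>2)"
proof -
  define Z where "Z = transpose_mat W * H + outer_prod b (ones_vec (n * K))"
  have Z: "Z \<in> carrier_mat K (n * K)"
    using W H b by (simp add: Z_def outer_prod_def ones_vec_def)
  have Zi: "Z $$ (m, j) = z j m" if "m < K" "j < n * K" for m j
    using W H b that
    by (simp add: Z_def z_def outer_prod_def ones_vec_def scalar_prod_def lessThan_atLeast0)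
  have "cross_entropy (col Z j) (col (smoothed_label_mat K n \<delta>) j)
      = lse K (z j) - (\<Sum>m<K. ((1 - \<delta>) * of_bool (m = j div n) + \<delta> / real K) * z j m)"
    if j: "j < n * K" for j
  proof -
    have k: "j div n < K" using j by (simp add: less_mult_imp_div_less mult.commute)
    have y: "col (smoothed_label_mat K n \<delta>) j $ m = (1 - \<delta>) * of_bool (m = j div n) + \<delta> / real K"
      if "m < K" for m
      using that j smoothed_label_mat_carrier[of K n \<delta>] by (simp add: smoothed_label_mat_index)
    have "(\<Sum>m<K. col (smoothed_label_mat K n \<delta>) j $ m)
        = (\<Sum>m<K. (1 - \<delta>) * of_bool (m = j div n)) + (\<Sum>m<K. \<delta> / real K)"
      unfolding sum.distrib[symmetric] by (intro sum.cong refl) (simp add: y)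
    also have "\<dots> = 1"
      using \<open>K > 0\<close> by (simp only: sum_delta_lessThan(2)[OF k]) simp
    finally have "(\<Sum>m<K. col (smoothed_label_mat K n \<delta>) j $ m) = 1" .
    moreover have "col Z j $ m = z j m" if "m < K" for m
      using that j Z Zi by simp
    ultimately show ?thesis
      using Z \<open>K > 0\<close> by (subst cross_entropy_eq_lse[of _ K]) (simp_all add: y lse_def)
  qed
  then show ?thesis
    using W H b Z
    by (simp add: ce_loss_def cross_entropy_mat_def frob_norm_def eucl_norm_def sum_nonneg
        flip: Z_def)
qed

section \<open>Global minimizers annihilate every nonnegative term\<close>

lemma ce_loss_decomposition:
  fixes a \<delta> lamH :: real
  assumes "n > 0" "K > 0" "lamH > 0"
    and WHb: "W \<in> carrier_mat d K" "H \<in> carrier_mat d (n * K)" "b \<in> carrier_vec K"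
  defines "S \<equiv> exp a + real K - 1"
  defines "c \<equiv> 1 / S - \<delta> / real K"
  defines "mean \<equiv> \<lambda>i. (\<Sum>m<K. W $$ (i, m)) / real K"
  defines "z \<equiv> \<lambda>j m. (\<Sum>i<d. W $$ (i, m) * H $$ (i, j)) + b $ m"
  shows "ce_loss K n lamW lamH lamb \<delta> W H b = ln S - a * exp a / S
      + 1 / real (n * K) * (\<Sum>j<n * K. lse_gap K (z j) (\<lambda>m. a * of_bool (m = j div n)))
      + lamH / 2 * (\<Sum>i<d. \<Sum>j<n * K.
          (H $$ (i, j) - c / (real n * lamH) * (W $$ (i, j div n) - mean i))\<^sup>2)
      + (lamW - c\<^sup>2 / (real n * lamH)) / 2 * (\<Sum>i<d. \<Sum>k<K. (W $$ (i, k) - mean i)\<^sup>2)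
      + lamW / 2 * real K * (\<Sum>i<d. (mean i)\<^sup>2)
      + lamb / 2 * (\<Sum>k<K. (b $ k)\<^sup>2)"
  using ce_loss_entries[OF assms(2) WHb]
    regularized_loss_decomposition[OF assms(1-3), where w = "\<lambda>i k. W $$ (i, k)"
      and h = "\<lambda>i j. H $$ (i, j)" and b = "\<lambda>k. b $ k" and a = a and \<delta> = \<delta> and d = d and lamW = lamW]
  unfolding S_def c_def mean_def z_def by simp

text \<open>The formula for \<open>a\<close> enters only through the relations assumed on
  \<open>a\<close>, \<open>c\<close> and \<open>s\<close>. The bounds on \<open>c\<close> make all
  coefficients of the decomposition nonnegative; the alternative
  \<open>a = 0 \<or> c = lamW * s\<close> lets an explicit point attain the constant.\<close>

lemma minimizer_structure:
  fixes d K n :: nat and lamW lamH lamb \<delta> a s :: real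
    and W H :: "real mat" and b :: "real vec"
  assumes "n > 0" "K > 0" "d \<ge> K" "lamW > 0" "lamH > 0" "lamb > 0"
    and min: "is_global_minimizer d K (n * K) (ce_loss K n lamW lamH lamb \<delta>) W H b"
  defines "S \<equiv> exp a + real K - 1"
  defines "c \<equiv> 1 / S - \<delta> / real K"
  assumes s: "s > 0" "real n * lamH = lamW * s\<^sup>2"
    and c: "0 \<le> c" "c \<le> lamW * s" and a: "a \<ge> 0" "a = 0 \<or> c = lamW * s"
  shows "\<And>i. i < d \<Longrightarrow> (\<Sum>k<K. W $$ (i, k)) = 0"
    and "\<And>i j. i < d \<Longrightarrow> j < n * K \<Longrightarrow> H $$ (i, j) = 1 / s * W $$ (i, j div n)"
    and "\<And>k m. k < K \<Longrightarrow> m < K \<Longrightarrow>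
      (\<Sum>i<d. W $$ (i, k) * W $$ (i, m)) = s * a * (of_bool (k = m) - 1 / real K)"
    and "b = 0\<^sub>v K"
proof -
  have WHb: "W \<in> carrier_mat d K" "H \<in> carrier_mat d (n * K)" "b \<in> carrier_vec K"
    using min by (auto simp: is_global_minimizer_def)
  have K0: "real K > 0" and n0: "real n > 0" using assms by auto
  have kappa: "c / (real n * lamH) = 1 / s" if "c = lamW * s"
    using s assms(4) that by (simp add: power2_eq_square)
  \<comment> \<open>As a difference of squares, the coefficient has its sign decided by
    \<open>lamW * s - c\<close>.\<close>
  have coef: "lamW - c\<^sup>2 / (real n * lamH) = (lamW * s + c) * (lamW * s - c) / (lamW * s\<^sup>2)"
    unfolding s(2) using s(1) assms(4) by (simp add: field_simps power2_eq_square)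

  \<comment> \<open>The witness is the centering matrix scaled by \<open>sqrt (s * a)\<close> and
    padded with zero rows, which fits because \<open>d \<ge> K\<close>. \<open>H0\<close> repeats
    its columns by class, divided by \<open>s\<close>.\<close>
  define W0 where "W0 = mat d K (\<lambda>(i, k).
    if i < K then sqrt (s * a) * (of_bool (k = i) - 1 / real K) else 0)"
  define H0 where "H0 = mat d (n * K) (\<lambda>(i, j). 1 / s * W0 $$ (i, j div n))"
  have WHb0: "W0 \<in> carrier_mat d K" "H0 \<in> carrier_mat d (n * K)" "0\<^sub>v K \<in> carrier_vec K"
    by (simp_all add: W0_def H0_def)
  have cls: "j div n < K" if "j < n * K" for j
    using that by (simp add: less_mult_imp_div_less mult.commute)
  have mean0: "(\<Sum>m<K. W0 $$ (i, m)) = 0" if "i < d" for i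
  proof (cases "i < K")
    case True
    have "(\<Sum>m<K. W0 $$ (i, m)) = (\<Sum>m<K. sqrt (s * a) * (of_bool (m = i) - 1 / real K))"
      using that True by (simp add: W0_def)
    also have "\<dots> = sqrt (s * a) * ((\<Sum>m<K. of_bool (m = i) * 1) - 1)"
      using K0 by (simp add: sum_subtractf flip: sum_distrib_left)
    finally show ?thesis by (simp only: sum_delta_lessThan(1)[OF True]) simp
  qed (use that in \<open>simp add: W0_def\<close>)
  \<comment> \<open>The centering matrix is symmetric and idempotent, so it is its own Gram
    matrix.\<close>
  have gram0: "(\<Sum>i<d. W0 $$ (i, m) * W0 $$ (i, k)) = s * a * (of_bool (m = k) - 1 / real K)"
    if "m < K" "k < K" for m k
  proof -
    have "(\<Sum>i<d. W0 $$ (i, m) * W0 $$ (i, k)) = (\<Sum>i<K. W0 $$ (i, m) * W0 $$ (i, k))"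
      using that \<open>d \<ge> K\<close> by (intro sum.mono_neutral_right) (auto simp: W0_def)
    also have "\<dots> = (\<Sum>i<K. s * a * ((of_bool (m = i) - 1 / real K) * (of_bool (k = i) - 1 / real K)))"
    proof (intro sum.cong refl)
      fix i assume "i \<in> {..<K}"
      moreover have "sqrt (s * a) * x * (sqrt (s * a) * y) = (sqrt (s * a))\<^sup>2 * (x * y)" for x y
        by (simp add: power2_eq_square mult_ac)
      ultimately show "W0 $$ (i, m) * W0 $$ (i, k)
          = s * a * ((of_bool (m = i) - 1 / real K) * (of_bool (k = i) - 1 / real K))"
        using that \<open>d \<ge> K\<close> s a by (simp add: W0_def)
    qed
    also have "\<dots> = s * a * (\<Sum>i<K. of_bool (i = m) * of_bool (k = i) - of_bool (i = m) * (1 / real K)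
        - of_bool (i = k) * (1 / real K) + 1 / real K * (1 / real K))"
      unfolding sum_distrib_left
      by (intro sum.cong refl) (auto simp: algebra_simps)
    also have "\<dots> = s * a * (of_bool (k = m) - 1 / real K)"
      unfolding sum.distrib sum_subtractf sum_delta_lessThan(1)[OF that(1)] sum_delta_lessThan(1)[OF that(2)]
      using K0 by simp
    finally show ?thesis by (simp add: eq_commute)
  qed
  have "ce_loss K n lamW lamH lamb \<delta> W0 H0 (0\<^sub>v K) = ln S - a * exp a / S"
  proof -
    \<comment> \<open>The logits of the witness are \<open>a e_k\<close> shifted by
      \<open>- a / K\<close>, and the gap ignores common shifts.\<close>
    have gap: "lse_gap K (\<lambda>m. (\<Sum>i<d. W0 $$ (i, m) * H0 $$ (i, j)) + 0\<^sub>v K $ m)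
        (\<lambda>m. a * of_bool (m = j div n)) = 0" if j: "j < n * K" for j
    proof -
      have "(\<Sum>i<d. W0 $$ (i, m) * H0 $$ (i, j)) = a * of_bool (m = j div n) - a / real K"
        if "m < K" for m
      proof -
        have "(\<Sum>i<d. W0 $$ (i, m) * H0 $$ (i, j)) = 1 / s * (\<Sum>i<d. W0 $$ (i, m) * W0 $$ (i, j div n))"
          using j by (simp add: H0_def sum_divide_distrib)
        also have "\<dots> = a * of_bool (m = j div n) - a / real K"
          using s unfolding gram0[OF that cls[OF j]] by (simp add: algebra_simps)
        finally show ?thesis .
      qed
      then show ?thesis
        unfolding lse_gap_nonneg_and_zero_iff(2)[OF assms(2)] by (intro exI[of _ "- a / real K"]) simp
    qed
    \<comment> \<open>For \<open>a = 0\<close> both sides are zero; otherwise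
      \<open>c = lamW * s\<close> makes the factor equal to \<open>1 / s\<close>.\<close>
    have H0: "H0 $$ (i, j) = c / (real n * lamH) * W0 $$ (i, j div n)" if "i < d" "j < n * K" for i j
    proof (cases "a = 0")
      case False
      then have "c / (real n * lamH) = 1 / s" using a(2) kappa by blast
      then show ?thesis using that unfolding H0_def by simp
    qed (use that cls[OF that(2)] in \<open>simp add: H0_def W0_def\<close>)
    have W0: "(lamW - c\<^sup>2 / (real n * lamH)) * (\<Sum>i<d. \<Sum>k<K. (W0 $$ (i, k))\<^sup>2) = 0"
    proof (cases "a = 0")
      case True
      then have "W0 $$ (i, k) = 0" if "i < d" "k < K" for i k using that by (simp add: W0_def)
      then show ?thesis by simp
    next
      case False
      then have "c = lamW * s" using a(2) by blast
      then show ?thesis unfolding coef by simp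
    qed
    show ?thesis
      using W0 gap unfolding ce_loss_decomposition[OF assms(1,2,5) WHb0, of _ _ \<delta> a] S_def c_def[unfolded S_def, symmetric]
      by (simp add: mean0 H0)
  qed
  then have le: "ce_loss K n lamW lamH lamb \<delta> W H b \<le> ln S - a * exp a / S"
    using min WHb0 unfolding is_global_minimizer_def by metis

  define mean where "mean i = (\<Sum>m<K. W $$ (i, m)) / real K" for i
  define z where "z j m = (\<Sum>i<d. W $$ (i, m) * H $$ (i, j)) + b $ m" for j m
  define T1 where "T1 = (\<Sum>j<n * K. lse_gap K (z j) (\<lambda>m. a * of_bool (m = j div n)))"
  define T2 where "T2 = (\<Sum>i<d. \<Sum>j<n * K.
          (H $$ (i, j) - c / (real n * lamH) * (W $$ (i, j div n) - mean i))\<^sup>2)"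
  define T3 where "T3 = (\<Sum>i<d. \<Sum>k<K. (W $$ (i, k) - mean i)\<^sup>2)"
  define T4 where "T4 = (\<Sum>i<d. (mean i)\<^sup>2)"
  define T5 where "T5 = (\<Sum>k<K. (b $ k)\<^sup>2)"
  \<comment> \<open>The minimizer costs at most the constant attained by the witness, so its excess,
    a sum of five nonnegative terms, is at most 0.\<close>
  have "1 / real (n * K) * T1 + lamH / 2 * T2 + (lamW - c\<^sup>2 / (real n * lamH)) / 2 * T3
      + lamW / 2 * real K * T4 + lamb / 2 * T5 \<le> 0"
    using le unfolding ce_loss_decomposition[OF assms(1,2,5) WHb, of _ _ \<delta> a]
      T1_def T2_def T3_def T4_def T5_def z_def mean_def c_def S_def by simp
  moreover have nn: "T1 \<ge> 0" "T2 \<ge> 0" "T3 \<ge> 0" "T4 \<ge> 0" "T5 \<ge> 0"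
    using lse_gap_nonneg_and_zero_iff(1)[OF assms(2)]
    unfolding T1_def T2_def T3_def T4_def T5_def by (auto intro!: sum_nonneg)
  moreover have "lamW - c\<^sup>2 / (real n * lamH) \<ge> 0"
    unfolding coef using s c assms(4) by simp
  \<comment> \<open>The third product cannot yet be simplified to \<open>T3 = 0\<close>, since its
    coefficient may be zero.\<close>
  ultimately have zero: "1 / real (n * K) * T1 = 0" "lamH / 2 * T2 = 0"
      "(lamW - c\<^sup>2 / (real n * lamH)) / 2 * T3 = 0" "lamW / 2 * real K * T4 = 0" "lamb / 2 * T5 = 0"
    using mult_nonneg_nonneg[of "1 / real (n * K)" T1] mult_nonneg_nonneg[of "lamH / 2" T2]
      mult_nonneg_nonneg[of "(lamW - c\<^sup>2 / (real n * lamH)) / 2" T3]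
      mult_nonneg_nonneg[of "lamW / 2 * real K" T4] mult_nonneg_nonneg[of "lamb / 2" T5] assms(4-6)
    by (smt (verit) divide_nonneg_nonneg of_nat_0_le_iff mult_nonneg_nonneg)+
  have "T4 = 0" using zero(4) assms(4) K0 by simp
  then have mean: "mean i = 0" if "i < d" for i
    using that by (simp add: T4_def sum_nonneg_eq_0_iff)
  then show W1: "(\<Sum>k<K. W $$ (i, k)) = 0" if "i < d" for i
    using that K0 by (auto simp: mean_def)
  have "T5 = 0" using zero(5) assms(6) by simp
  then have b: "b $ k = 0" if "k < K" for k
    using that by (simp add: T5_def sum_nonneg_eq_0_iff)
  then show "b = 0\<^sub>v K" using WHb by auto
  have "T2 = 0" using zero(2) assms(5) by simp
  then have H: "H $$ (i, j) = c / (real n * lamH) * W $$ (i, j div n)" if "i < d" "j < n * K" for i j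
    using that by (simp add: T2_def sum_nonneg_eq_0_iff sum_nonneg mean)
  \<comment> \<open>Away from \<open>c = lamW * s\<close> the coefficient of \<open>T3\<close> is
    strictly positive, and \<open>W\<close> collapses to zero.\<close>
  have W0: "W $$ (i, k) = 0" if "c \<noteq> lamW * s" "i < d" "k < K" for i k
  proof -
    have "lamW - c\<^sup>2 / (real n * lamH) > 0"
      unfolding coef using s c that(1) assms(4) by (simp add: add_pos_nonneg)
    then have "T3 = 0" using zero(3) by simp
    then show ?thesis
      using that by (simp add: T3_def sum_nonneg_eq_0_iff sum_nonneg mean)
  qed
  show Hs: "H $$ (i, j) = 1 / s * W $$ (i, j div n)" if "i < d" "j < n * K" for i j
  proof (cases "c = lamW * s")
    case True
    show ?thesis using H[OF that] unfolding kappa[OF True] .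
  next
    case False
    then show ?thesis using H[OF that] W0[OF False that(1) cls[OF that(2)]] by simp
  qed
  show "(\<Sum>i<d. W $$ (i, k) * W $$ (i, m)) = s * a * (of_bool (k = m) - 1 / real K)"
    if "k < K" "m < K" for k m
  proof -
    \<comment> \<open>Sample \<open>k * n\<close> is the first one of class \<open>k\<close>; its
      logits yield row \<open>k\<close> of the Gram matrix of \<open>W\<close>.\<close>
    have j: "k * n < n * K" "k * n div n = k" using that assms(1) by auto
    have "T1 = 0" using zero(1) n0 K0 by simp
    then have "\<forall>j<n * K. lse_gap K (z j) (\<lambda>m. a * of_bool (m = j div n)) = 0"
      using lse_gap_nonneg_and_zero_iff(1)[OF assms(2)] by (simp add: T1_def sum_nonneg_eq_0_iff)
    from this[rule_format, OF j(1)] have "lse_gap K (z (k * n)) (\<lambda>m. a * of_bool (m = k)) = 0"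
      unfolding j(2) .
    then obtain \<mu> where "\<And>m. m < K \<Longrightarrow> z (k * n) m = a * of_bool (m = k) + \<mu>"
      unfolding lse_gap_nonneg_and_zero_iff(2)[OF assms(2)] by blast
    moreover have "z (k * n) m = 1 / s * (\<Sum>i<d. W $$ (i, k) * W $$ (i, m))" if "m < K" for m
      using that j by (simp add: z_def Hs b sum_distrib_left mult_ac)
    ultimately have gram: "(\<Sum>i<d. W $$ (i, k) * W $$ (i, m)) = s * (a * of_bool (m = k) + \<mu>)"
      if "m < K" for m
      using that s by (fastforce simp: field_simps)
    \<comment> \<open>The vanishing gap leaves the shift \<open>\<mu>\<close> open. Since the rows
      of \<open>W\<close> sum to zero, so does each row of the Gram matrix, and this fixes
      \<open>\<mu>\<close>.\<close>
    have "(\<Sum>m<K. \<Sum>i<d. W $$ (i, k) * W $$ (i, m)) = 0"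
      by (subst sum.swap) (simp add: W1 flip: sum_distrib_left)
    then have "0 = (\<Sum>m<K. s * (a * of_bool (m = k) + \<mu>))" by (simp add: gram)
    also have "\<dots> = s * ((\<Sum>m<K. a * of_bool (m = k)) + real K * \<mu>)"
      by (simp only: sum.distrib flip: sum_distrib_left) simp
    also have "\<dots> = s * (a + real K * \<mu>)"
      using sum_delta_lessThan(2)[OF that(1), of "\<lambda>_. a"] by simp
    finally have "a + real K * \<mu> = 0" using s(1) by simp
    then have "\<mu> = - a / real K" using K0 by (simp add: field_simps)
    then show ?thesis using gram[OF that(2)] by (auto simp: algebra_simps)
  qed
qed

section \<open>From the Gram matrix to an isometry\<close>

lemma centering_mat_carrier: "centering_mat K \<in> carrier_mat K K"
  by (intro carrier_matI) (simp_all add: centering_mat_def outer_prod_def ones_vec_def)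

lemma mult_centering_mat_index:
  assumes "P \<in> carrier_mat d K" "i < d" "k < K"
  shows "(P * centering_mat K) $$ (i, k) = P $$ (i, k) - (\<Sum>m<K. P $$ (i, m)) / real K"
proof -
  have "(P * centering_mat K) $$ (i, k) = (\<Sum>m<K. P $$ (i, m) * (of_bool (m = k) - 1 / real K))"
    using assms by (auto simp: centering_mat_def outer_prod_def ones_vec_def scalar_prod_def
        lessThan_atLeast0 intro!: sum.cong)
  also have "\<dots> = P $$ (i, k) - (\<Sum>m<K. P $$ (i, m)) / real K"
    by (simp only: right_diff_distrib sum_subtractf sum_delta_lessThan(2)[OF assms(3)])
      (simp add: sum_divide_distrib)
  finally show ?thesis .
qed

lemma mult_label_mat_index:
  assumes "M \<in> carrier_mat d K" "i < d" "j < n * K"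
  shows "(M * label_mat K n) $$ (i, j) = M $$ (i, j div n)"
proof -
  have k: "j div n < K" using assms(3) by (simp add: less_mult_imp_div_less mult.commute)
  have "(M * label_mat K n) $$ (i, j) = (\<Sum>m<K. M $$ (i, m) * label_mat K n $$ (m, j))"
    using assms carrier_matD[OF label_mat_carrier[of K n]]
    by (simp add: scalar_prod_def lessThan_atLeast0)
  also have "\<dots> = (\<Sum>m<K. M $$ (i, m) * of_bool (m = j div n))"
    using assms(3) by simp
  also have "\<dots> = M $$ (i, j div n)" by (rule sum_delta_lessThan(2)[OF k])
  finally show ?thesis .
qed

text \<open>Columns that sum to zero span at most \<open>K - 1\<close> dimensions, which leaves a
  free direction because \<open>d \<ge> K\<close>.\<close>

lemma ex_unit_vector_orthogonal_to_columns:
  fixes u :: "nat \<Rightarrow> nat \<Rightarrow> real"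
  assumes "K > 0" "d \<ge> K" and row_sums: "\<And>i. i < d \<Longrightarrow> (\<Sum>k<K. u i k) = 0"
  shows "\<exists>q. (\<Sum>i<d. (q i)\<^sup>2) = 1 \<and> (\<forall>k<K. (\<Sum>i<d. u i k * q i) = 0)"
proof -
  \<comment> \<open>The first \<open>K - 1\<close> columns of \<open>u\<close> become rows, padded
    by zero rows to a square matrix. Row \<open>d - 1\<close> is zero, so the determinant vanishes
    and a kernel vector exists.\<close>
  define A where "A = mat d d (\<lambda>(k, i). if k < K - 1 then u i k else 0)"
  have A: "A \<in> carrier_mat d d" by (simp add: A_def)
  have "\<not> d - 1 < K - 1" using assms(2) by simp
  then have "det A = 0"
    using assms(1,2) by (subst laplace_expansion_row[OF A, of "d - 1"]) (auto simp: A_def)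
  then obtain v where v: "v \<in> carrier_vec d" "v \<noteq> 0\<^sub>v d" "A *\<^sub>v v = 0\<^sub>v d"
    using det_0_iff_vec_prod_zero[OF A] by blast
  define r where "r = sqrt (\<Sum>i<d. (v $ i)\<^sup>2)"
  obtain i where "i < d" "v $ i \<noteq> 0" using v(1,2) by (auto simp: vec_eq_iff)
  then have sq_pos: "(\<Sum>i<d. (v $ i)\<^sup>2) > 0"
    by (intro sum_pos2[of _ i]) auto
  have orth: "(\<Sum>i<d. u i k * v $ i) = 0" if "k < K - 1" for k
  proof -
    have "(A *\<^sub>v v) $ k = (\<Sum>i<d. u i k * v $ i)"
      using that assms v(1) by (simp add: A_def scalar_prod_def lessThan_atLeast0)
    then show ?thesis using that assms v(3) by simp
  qed
  \<comment> \<open>The omitted column is minus the sum of the others, so orthogonality extends to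
    it.\<close>
  have "(\<Sum>k<K. \<Sum>i<d. u i k * v $ i) = 0"
    by (subst sum.swap) (simp add: row_sums flip: sum_distrib_right)
  moreover have "(\<Sum>k<K. \<Sum>i<d. u i k * v $ i)
      = (\<Sum>k<K - 1. \<Sum>i<d. u i k * v $ i) + (\<Sum>i<d. u i (K - 1) * v $ i)"
    using assms(1) by (cases K) simp_all
  ultimately have "(\<Sum>i<d. u i (K - 1) * v $ i) = 0" by (simp add: orth)
  then have orth: "(\<Sum>i<d. u i k * v $ i) = 0" if "k < K" for k
    using that orth[of k] by (cases "k = K - 1") auto
  show ?thesis
  proof (intro exI[of _ "\<lambda>i. v $ i / r"] conjI allI impI)
    show "(\<Sum>i<d. (v $ i / r)\<^sup>2) = 1"
      using sq_pos by (simp add: r_def power_divide flip: sum_divide_distrib)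
    show "(\<Sum>i<d. u i k * (v $ i / r)) = 0" if "k < K" for k
      using orth[OF that] by (simp flip: sum_divide_distrib)
  qed
qed

text \<open>A matrix with Gram matrix \<open>I - 11\<^sup>T / K\<close> becomes an isometry once \<open>q 1\<^sup>T / \<surd>K\<close> is added,
  for a unit vector \<open>q\<close> orthogonal to its columns; centering removes the added term again.\<close>

lemma ex_isometry_centering:
  fixes U :: "real mat"
  assumes U: "U \<in> carrier_mat d K" and "K > 0" "d \<ge> K"
    and row_sums: "\<And>i. i < d \<Longrightarrow> (\<Sum>k<K. U $$ (i, k)) = 0"
    and gram: "\<And>k m. k < K \<Longrightarrow> m < K \<Longrightarrow>
      (\<Sum>i<d. U $$ (i, k) * U $$ (i, m)) = of_bool (k = m) - 1 / real K"
  shows "\<exists>P \<in> carrier_mat d K. transpose_mat P * P = 1\<^sub>m K \<and> U = P * centering_mat K"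
proof -
  obtain q where q: "(\<Sum>i<d. (q i)\<^sup>2) = 1"
      "\<And>k. k < K \<Longrightarrow> (\<Sum>i<d. U $$ (i, k) * q i) = 0"
    using ex_unit_vector_orthogonal_to_columns[OF assms(2,3), of "\<lambda>i k. U $$ (i, k)"] row_sums by blast
  define P where "P = mat d K (\<lambda>(i, k). U $$ (i, k) + q i / sqrt (real K))"
  have P: "P \<in> carrier_mat d K" by (simp add: P_def)
  have "transpose_mat P * P = 1\<^sub>m K"
  proof (rule eq_matI)
    fix k m assume "k < dim_row (1\<^sub>m K :: real mat)" "m < dim_col (1\<^sub>m K :: real mat)"
    then have km: "k < K" "m < K" by auto
    have "(transpose_mat P * P) $$ (k, m)
        = (\<Sum>i<d. (U $$ (i, k) + q i / sqrt (real K)) * (U $$ (i, m) + q i / sqrt (real K)))"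
      using km by (simp add: P_def scalar_prod_def lessThan_atLeast0)
    also have "\<dots> = (\<Sum>i<d. U $$ (i, k) * U $$ (i, m) + U $$ (i, k) * q i / sqrt (real K)
        + U $$ (i, m) * q i / sqrt (real K) + (q i)\<^sup>2 / real K)"
      by (intro sum.cong refl) (simp add: algebra_simps power2_eq_square)
    \<comment> \<open>The mixed terms vanish by orthogonality, and the square of \<open>q\<close>
      contributes the missing \<open>1 / real K\<close>.\<close>
    also have "\<dots> = of_bool (k = m)"
      by (simp add: sum.distrib gram km q flip: sum_divide_distrib)
    finally show "(transpose_mat P * P) $$ (k, m) = 1\<^sub>m K $$ (k, m)"
      using km by simp
  qed (auto simp: P_def)
  moreover have "U = P * centering_mat K"
  proof (rule eq_matI)
    fix i k assume "i < dim_row (P * centering_mat K)" "k < dim_col (P * centering_mat K)"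
    then have ik: "i < d" "k < K"
      using P by (auto simp: centering_mat_def outer_prod_def ones_vec_def)
    have "(\<Sum>m<K. P $$ (i, m)) = real K * (q i / sqrt (real K))"
      using ik by (simp add: P_def sum.distrib row_sums)
    then show "U $$ (i, k) = (P * centering_mat K) $$ (i, k)"
      unfolding mult_centering_mat_index[OF P ik] using ik \<open>K > 0\<close> by (simp add: P_def)
  qed (use U P in \<open>auto simp: centering_mat_def outer_prod_def ones_vec_def\<close>)
  ultimately show ?thesis using P by blast
qed

text \<open>Serves the case \<open>a = 0\<close>, where \<open>W\<close> vanishes and does not
  determine \<open>P\<close>.\<close>

lemma ex_isometry:
  assumes "d \<ge> K"
  shows "\<exists>P \<in> carrier_mat d K. transpose_mat P * P = (1\<^sub>m K :: real mat)"
proof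
  define P :: "real mat" where "P = mat d K (\<lambda>(i, k). of_bool (i = k))"
  show "P \<in> carrier_mat d K" by (simp add: P_def)
  show "transpose_mat P * P = 1\<^sub>m K"
  proof (rule eq_matI)
    fix k m assume "k < dim_row (1\<^sub>m K :: real mat)" "m < dim_col (1\<^sub>m K :: real mat)"
    then have km: "k < K" "m < K" by auto
    then have "(transpose_mat P * P) $$ (k, m) = (\<Sum>i<d. of_bool (i = k) * of_bool (i = m))"
      by (simp add: P_def scalar_prod_def lessThan_atLeast0)
    also have "\<dots> = of_bool (k = m)"
      using km assms by (intro sum_delta_lessThan) simp
    finally show "(transpose_mat P * P) $$ (k, m) = 1\<^sub>m K $$ (k, m)"
      using km by simp
  qed (auto simp: P_def)
qed

section \<open>The threshold for \<open>a\<close> and the assembly of the minimizer\<close>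

lemma a_smooth_optimality:
  fixes lamW lamH \<delta> :: real
  assumes "n > 0" "K > 0" "lamW > 0" "lamH > 0" "0 \<le> \<delta>" "\<delta> < 1"
  defines "a \<equiv> a_smooth K n lamW lamH \<delta>" and "s \<equiv> sqrt (real n * lamH / lamW)"
  defines "c \<equiv> 1 / (exp a + real K - 1) - \<delta> / real K"
  shows "a \<ge> 0" "0 \<le> c" "c \<le> lamW * s" "a = 0 \<or> c = lamW * s"
proof -
  define t where "t = sqrt (real K * real (n * K)) * sqrt (lamW * lamH) + \<delta>"
  have K0: "real K > 0" using assms by simp
  have "lamW * s = sqrt (lamW\<^sup>2) * s" using assms by simp
  also have "\<dots> = sqrt (real n * lamW * lamH)"
    using assms unfolding s_def real_sqrt_mult[symmetric]
    by (simp add: power2_eq_square mult_ac)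
  finally have ls: "lamW * s = sqrt (real n * lamW * lamH)" .
  have "sqrt (real K * real (n * K)) = real K * sqrt (real n)"
    by (simp add: real_sqrt_mult)
  \<comment> \<open>In this form \<open>t \<ge> 1\<close> says
    \<open>(1 - \<delta>) / K \<le> lamW * s\<close>.\<close>
  then have t: "t = real K * (lamW * s) + \<delta>"
    unfolding t_def ls by (simp add: real_sqrt_mult)
  have s: "s > 0" using assms by (simp add: s_def)
  have a: "a = (if t \<ge> 1 then 0 else ln (real K / t - real K + 1))"
    by (simp add: a_def a_smooth_def t_def Let_def)
  have "a \<ge> 0 \<and> 0 \<le> c \<and> c \<le> lamW * s \<and> (a = 0 \<or> c = lamW * s)"
  proof (cases "t \<ge> 1")
    case True
    \<comment> \<open>At \<open>a = 0\<close> the normalizer \<open>exp a + K - 1\<close> is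
      \<open>K\<close>, so \<open>c \<le> lamW * s\<close> is the threshold condition
      itself.\<close>
    then have "a = 0" "c = (1 - \<delta>) / real K" by (simp_all add: a c_def diff_divide_distrib)
    then show ?thesis using True assms K0 by (simp add: t field_simps)
  next
    case False
    have "t > 0" unfolding t using K0 s assms by (intro add_pos_nonneg) auto
    moreover from this have "real K / t > real K" using False K0 by (simp add: field_simps)
    ultimately have a: "a = ln (real K / t - real K + 1)" "a \<ge> 0" using False a by auto
    \<comment> \<open>The logarithm is chosen so that \<open>exp a + K - 1 = K / t\<close>, whence
      \<open>c = (t - \<delta>) / K\<close>.\<close>
    with \<open>real K / t > real K\<close> have "c = t / real K - \<delta> / real K"
      by (simp add: c_def)
    also have "\<dots> = lamW * s" using K0 by (simp add: t field_simps)
    finally show ?thesis using a(2) s assms by simp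
  qed
  then show "a \<ge> 0" "0 \<le> c" "c \<le> lamW * s" "a = 0 \<or> c = lamW * s" by auto
qed

theorem theorem4p1:
  fixes d K n :: nat and lamW lamH lamb \<delta> :: real
    and W H :: "real mat" and b :: "real vec"
  assumes "n \<ge> 1" and "K \<ge> 2" and "d \<ge> K"
    and "lamW > 0" and "lamH > 0" and "lamb > 0"
    and "0 \<le> \<delta>" and "\<delta> < 1"
    and "is_global_minimizer d K (n * K) (ce_loss K n lamW lamH lamb \<delta>) W H b"
  shows "\<exists>P \<in> carrier_mat d K.
      transpose_mat P * P = 1\<^sub>m K \<and>
      W = (root 4 (real n * lamH / lamW) * sqrt (a_smooth K n lamW lamH \<delta>))
            \<cdot>\<^sub>m (P * centering_mat K) \<and>
      H = (root 4 (lamW / (real n * lamH)) * sqrt (a_smooth K n lamW lamH \<delta>))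
            \<cdot>\<^sub>m (P * centering_mat K * label_mat K n) \<and>
      b = 0\<^sub>v K"
proof -
  define a where "a = a_smooth K n lamW lamH \<delta>"
  define s where "s = sqrt (real n * lamH / lamW)"
  have pos: "n > 0" "K > 0" using assms by auto
  have s0: "s > 0" using assms by (simp add: s_def)
  have s2: "real n * lamH = lamW * s\<^sup>2" using assms by (simp add: s_def)
  note opt = a_smooth_optimality[OF pos assms(4,5,7,8), folded a_def s_def]
  note str = minimizer_structure[OF pos assms(3-6,9) s0 s2 opt(2,3,1,4)]
  have W: "W \<in> carrier_mat d K" and H: "H \<in> carrier_mat d (n * K)"
    using assms(9) by (auto simp: is_global_minimizer_def)
  have cls: "j div n < K" if "j < n * K" for j
    using that by (simp add: less_mult_imp_div_less mult.commute)
  have root4: "root 4 x = sqrt (sqrt x)" for x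
    using real_root_mult_exp[of 2 2 x] by (simp add: sqrt_def)
  have coefW: "root 4 (real n * lamH / lamW) * sqrt a = sqrt (s * a)"
    by (simp add: root4 s_def real_sqrt_mult)
  have inverse_s: "sqrt (lamW / (real n * lamH)) = 1 / s" by (simp add: s_def real_sqrt_divide)
  \<comment> \<open>Both sides are \<open>sqrt a / sqrt s\<close>; the right one matches
    \<open>H\<close> as \<open>1 / s\<close> times the repeated columns of \<open>W\<close>.\<close>
  have coefH: "root 4 (lamW / (real n * lamH)) * sqrt a = 1 / s * sqrt (s * a)"
    unfolding root4 inverse_s using s0 by (simp add: real_sqrt_mult real_sqrt_divide field_simps)
  have "\<exists>P \<in> carrier_mat d K. transpose_mat P * P = 1\<^sub>m K \<and>
      W = sqrt (s * a) \<cdot>\<^sub>m (P * centering_mat K)"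
  proof (cases "a = 0")
    case True
    \<comment> \<open>The Gram matrix has zero diagonal, so each column of \<open>W\<close> has norm
      zero and any isometry fits.\<close>
    have "W $$ (i, k) = 0" if "i < d" "k < K" for i k
    proof -
      have "(\<Sum>i<d. W $$ (i, k) * W $$ (i, k)) = 0"
        using str(3)[of k k] that True by simp
      then show ?thesis using that by (simp add: sum_nonneg_eq_0_iff)
    qed
    moreover obtain P where "P \<in> carrier_mat d K" "transpose_mat P * P = (1\<^sub>m K :: real mat)"
      using ex_isometry[OF assms(3)] by blast
    ultimately show ?thesis
      using W True carrier_matD[OF centering_mat_carrier[of K]]
      by (intro bexI[of _ P] conjI eq_matI) auto
  next
    case False
    \<comment> \<open>Dividing by \<open>sqrt (s * a)\<close> turns the Gram matrix of
      \<open>W\<close> into the centering matrix.\<close>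
    define r where "r = sqrt (s * a)"
    have sa: "s * a > 0" using False opt(1) s0 by simp
    then have r0: "r > 0" and r2: "r * r = s * a" by (simp_all add: r_def)
    define U where "U = (1 / r) \<cdot>\<^sub>m W"
    have U: "U \<in> carrier_mat d K" using W by (simp add: U_def)
    have Ui: "U $$ (i, k) = W $$ (i, k) / r" if "i < d" "k < K" for i k
      using W that by (simp add: U_def)
    have "(\<Sum>k<K. U $$ (i, k)) = 0" if "i < d" for i
      using str(1)[OF that] that by (simp add: Ui flip: sum_divide_distrib)
    moreover have "(\<Sum>i<d. U $$ (i, k) * U $$ (i, m)) = of_bool (k = m) - 1 / real K"
      if "k < K" "m < K" for k m
    proof -
      have "(\<Sum>i<d. U $$ (i, k) * U $$ (i, m)) = (\<Sum>i<d. W $$ (i, k) * W $$ (i, m)) / (r * r)"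
        using that by (simp add: Ui sum_divide_distrib)
      then show ?thesis unfolding str(3)[OF that] r2 using s0 False by simp
    qed
    ultimately obtain P where "P \<in> carrier_mat d K" "transpose_mat P * P = 1\<^sub>m K"
        "U = P * centering_mat K"
      using ex_isometry_centering[OF U pos(2) assms(3)] by blast
    moreover have "W = r \<cdot>\<^sub>m U" using r0 W by (intro eq_matI) (auto simp: U_def)
    ultimately show ?thesis unfolding r_def by blast
  qed
  then obtain P where P: "P \<in> carrier_mat d K" "transpose_mat P * P = 1\<^sub>m K"
    "W = sqrt (s * a) \<cdot>\<^sub>m (P * centering_mat K)" by blast
  have PC: "P * centering_mat K \<in> carrier_mat d K"
    using P(1) centering_mat_carrier by (rule mult_carrier_mat)
  have PCY: "P * centering_mat K * label_mat K n \<in> carrier_mat d (n * K)"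
    using PC label_mat_carrier by (rule mult_carrier_mat)
  \<comment> \<open>Right multiplication by \<open>label_mat K n\<close> repeats column
    \<open>k\<close> over class \<open>k\<close>, just as \<open>H\<close> repeats the columns of
    \<open>W\<close>.\<close>
  have "H = (1 / s * sqrt (s * a)) \<cdot>\<^sub>m (P * centering_mat K * label_mat K n)"
  proof (rule eq_matI)
    fix i j
    assume "i < dim_row ((1 / s * sqrt (s * a)) \<cdot>\<^sub>m (P * centering_mat K * label_mat K n))"
      "j < dim_col ((1 / s * sqrt (s * a)) \<cdot>\<^sub>m (P * centering_mat K * label_mat K n))"
    then have ij: "i < d" "j < n * K" using carrier_matD[OF PCY] by auto
    have "H $$ (i, j) = 1 / s * W $$ (i, j div n)" using str(2)[OF ij] .
    also have "W $$ (i, j div n) = sqrt (s * a) * (P * centering_mat K) $$ (i, j div n)"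
      unfolding P(3) using carrier_matD[OF PC] ij cls by (intro index_smult_mat) auto
    also have "(P * centering_mat K) $$ (i, j div n) = (P * centering_mat K * label_mat K n) $$ (i, j)"
      using mult_label_mat_index[OF PC ij] by simp
    finally show "H $$ (i, j)
        = ((1 / s * sqrt (s * a)) \<cdot>\<^sub>m (P * centering_mat K * label_mat K n)) $$ (i, j)"
      using carrier_matD[OF PCY] ij by simp
  qed (use carrier_matD[OF PCY] H in auto)
  then show ?thesis
    using P str(4) unfolding a_def[symmetric] coefW coefH by blast
qed

end
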